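(* Let $E$ and $F$ be Banach spaces, $x_0\in E$, and let $f\in\mathcal H(E;F)$ have Taylor series expansion at $x_0$ given by $\sum_{m=0}^\infty P_mf(x_0)$. For $1\le p<\infty$, the following statements are equivalent. (i) $f$ is $p$-compact at $x_0$. (ii) $P_mf(x_0)\in\mathcal P_{K_p}(^mE;F)$ for all $m$, and $\limsup_{m\to\infty}\kappa_p(P_mf(x_0))^{1/m}<\infty$.
   Context: Banach spaces are complex; $B_E$ is the closed unit ball of $E$. $\mathcal P(^mE;F)$ is the space of continuous $m$-homogeneous polynomials from $E$ to $F$. $\mathcal H(E;F)$ is the space of entire (everywhere holomorphic) functions $f:E\to F$; for $x_0\in E$, $P_mf(x_0)\in\mathcal P(^mE;F)$ are the polynomials such that $f(x)=\sum_{m\ge0}P_mf(x_0)(x-x_0)$ uniformly for $x$ in some neighborhood of $x_0$. $\ell_p(F)$ is the Banach space of $p$-summable sequences in $F$ with its natural norm $\|\cdot\|_p$. For $(y_n)_n\in\ell_p(F)$ put $p\text{-co}\{y_n\}=\{\sum_n\alpha_ny_n:(\alpha_n)_n\in B_{\ell_q}\}$, $\frac1p+\frac1q=1$. A set $K\subset F$ is relatively $p$-compact if it is contained in the closure of $p\text{-co}\{y_n\}$ for some $(y_n)_n\in\ell_p(F)$, and $m_p(K)=\inf\{\|(y_n)_n\|_p:K\subset p\text{-co}\{y_n\}\}$. $P\in\mathcal P(^mE;F)$ is $p$-compact if $P(B_E)$ is relatively $p$-compact; $\mathcal P_{K_p}(^mE;F)$ is the space of such polynomials and $\kappa_p(P)=m_p(P(B_E))$.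 A function $f\in\mathcal H(E;F)$ is $p$-compact at $x_0$ if there is a neighborhood $V$ of $x_0$ such that $f(V)$ is relatively $p$-compact in $F$. *)

theory Defs
  imports "HOL-Analysis.Analysis"
begin

text \<open>
  The class \<open>banach\<close> of the library is that of real Banach spaces. A complex Banach space is one
  with a complex scalar multiplication extending the real one, for which the norm is homogeneous.
\<close>

class complex_normed_vector = real_normed_vector +
  fixes scaleC :: "complex \<Rightarrow> 'a \<Rightarrow> 'a"  (infixr "*\<^sub>C" 75)
  assumes scaleC_add_right: "a *\<^sub>C (x + y) = a *\<^sub>C x + a *\<^sub>C y"
    and scaleC_add_left: "(a + b) *\<^sub>C x = a *\<^sub>C x + b *\<^sub>C x"
    and scaleC_scaleC: "a *\<^sub>C (b *\<^sub>C x) = (a * b) *\<^sub>C x"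
    and scaleC_of_real: "complex_of_real r *\<^sub>C x = r *\<^sub>R x"
    and norm_scaleC: "norm (a *\<^sub>C x) = cmod a * norm x"

class complex_banach = complex_normed_vector + banach

instantiation complex :: complex_banach
begin

definition scaleC_complex :: "complex \<Rightarrow> complex \<Rightarrow> complex" where
  "scaleC_complex a x = a * x"

instance
  by standard (auto simp: scaleC_complex_def algebra_simps norm_mult scaleR_conv_of_real)

end

lemma vector_space_scaleC:
  "vector_space (scaleC :: complex \<Rightarrow> 'a::complex_normed_vector \<Rightarrow> 'a)"
proof
  show "1 *\<^sub>C x = x" for x :: 'a
    using scaleC_of_real[of 1 x] by simp
qed (simp_all add: scaleC_add_right scaleC_add_left scaleC_scaleC)


text \<open>
  An \<open>m\<close>-linear map is encoded as a function of sequences of vectors that depends only on the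
  entries with index below \<open>m\<close>. For \<open>m = 0\<close> these are the constants.
\<close>

definition multilinear_map ::
    "nat \<Rightarrow> ((nat \<Rightarrow> 'e::complex_normed_vector) \<Rightarrow> 'f::complex_normed_vector) \<Rightarrow> bool" where
  "multilinear_map m A \<longleftrightarrow>
     (\<forall>x y. (\<forall>i<m. x i = y i) \<longrightarrow> A x = A y) \<and>
     (\<forall>i<m. \<forall>x. Vector_Spaces.linear (*\<^sub>C) (*\<^sub>C) (\<lambda>z. A (x(i := z))))"

definition hom_polys ::
    "nat \<Rightarrow> ('e::complex_normed_vector \<Rightarrow> 'f::complex_normed_vector) set" where
  "hom_polys m =
     {P. continuous_on UNIV P \<and> (\<exists>A. multilinear_map m A \<and> (\<forall>x. P x = A (\<lambda>_. x)))}"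

definition has_taylor_expansion ::
    "('e::complex_normed_vector \<Rightarrow> 'f::complex_normed_vector) \<Rightarrow> 'e \<Rightarrow> (nat \<Rightarrow> 'e \<Rightarrow> 'f) \<Rightarrow> bool" where
  "has_taylor_expansion f x0 P \<longleftrightarrow>
     (\<forall>m. P m \<in> hom_polys m) \<and>
     (\<exists>V. x0 \<in> interior V \<and>
        uniform_limit V (\<lambda>N x. \<Sum>m<N. P m (x - x0)) f sequentially)"

definition entire :: "('e::complex_normed_vector \<Rightarrow> 'f::complex_normed_vector) \<Rightarrow> bool" where
  "entire f \<longleftrightarrow> (\<forall>x. \<exists>P. has_taylor_expansion f x P)"


definition lp_seqs :: "real \<Rightarrow> (nat \<Rightarrow> 'f::real_normed_vector) set" where
  "lp_seqs p = {y. summable (\<lambda>n. norm (y n) powr p)}"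

definition lp_norm :: "real \<Rightarrow> (nat \<Rightarrow> 'f::real_normed_vector) \<Rightarrow> real" where
  "lp_norm p y = (\<Sum>n. norm (y n) powr p) powr (1 / p)"

text \<open>
  The closed unit ball of the scalar sequence space with exponent \<open>q\<close> conjugate to \<open>p\<close>,
  that is \<open>q = \<infinity>\<close> (bounded sequences, supremum norm) for \<open>p = 1\<close>, and
  \<open>q = p / (p - 1)\<close> for \<open>1 < p < \<infinity>\<close>.
\<close>

definition conj_lp_ball :: "real \<Rightarrow> (nat \<Rightarrow> complex) set" where
  "conj_lp_ball p =
     (if p = 1 then {\<alpha>. \<forall>n. cmod (\<alpha> n) \<le> 1}
      else {\<alpha> \<in> lp_seqs (p / (p - 1)). lp_norm (p / (p - 1)) \<alpha> \<le> 1})"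

definition p_co :: "real \<Rightarrow> (nat \<Rightarrow> 'f::complex_banach) \<Rightarrow> 'f set" where
  "p_co p y = (\<lambda>\<alpha>. \<Sum>n. \<alpha> n *\<^sub>C y n) ` conj_lp_ball p"

definition rel_p_compact :: "real \<Rightarrow> 'f::complex_banach set \<Rightarrow> bool" where
  "rel_p_compact p K \<longleftrightarrow> (\<exists>y \<in> lp_seqs p. K \<subseteq> closure (p_co p y))"

text \<open>
  The infimum is taken in the reals, so \<open>m_p p K\<close> is only meaningful if some \<open>y\<close> is
  admissible, which is the case for relatively \<open>p\<close>-compact \<open>K\<close> (the sets \<open>p_co p y\<close> are closed).
\<close>

definition m_p :: "real \<Rightarrow> 'f::complex_banach set \<Rightarrow> real" where
  "m_p p K = Inf {lp_norm p y |y. y \<in> lp_seqs p \<and> K \<subseteq> p_co p y}"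

definition p_compact_polys ::
    "real \<Rightarrow> nat \<Rightarrow> ('e::complex_banach \<Rightarrow> 'f::complex_banach) set" where
  "p_compact_polys p m = {P \<in> hom_polys m. rel_p_compact p (P ` cball 0 1)}"

definition kappa_p :: "real \<Rightarrow> ('e::complex_banach \<Rightarrow> 'f::complex_banach) \<Rightarrow> real" where
  "kappa_p p P = m_p p (P ` cball 0 1)"

definition p_compact_at ::
    "real \<Rightarrow> ('e::complex_banach \<Rightarrow> 'f::complex_banach) \<Rightarrow> 'e \<Rightarrow> bool" where
  "p_compact_at p f x0 \<longleftrightarrow> (\<exists>V. x0 \<in> interior V \<and> rel_p_compact p (f ` V))"

end

theory Submission
  imports Defs
begin

text \<open>
  Everything rests on \<open>p_co p y\<close> being a compact, convex, balanced set: it is the image of the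
  dual unit ball, which is compact for coordinatewise convergence, under a map that is continuous
  because the series converges uniformly on the ball.

  If \<open>f\<close> maps a ball of radius \<open>e\<close> around \<open>x0\<close> into such a set \<open>K\<close>, Cauchy's formula, with the
  integral replaced by means over the \<open>N\<close>-th roots of unity and \<open>N\<close> tending to infinity, puts
  \<open>P m x\<close> into \<open>K\<close> for small \<open>x\<close>, so \<open>kappa_p p (P m)\<close> grows at most like \<open>1 / e ^ m\<close>.
  Conversely, if it grows at most like \<open>C ^ m\<close>, then for \<open>norm x \<le> 1 / (4 * C)\<close> the vectors
  \<open>P m x\<close> lie in sets \<open>p_co p (z m)\<close> with \<open>lp_norm p (z m)\<close> of order \<open>1 / 4 ^ m\<close>, and the
  \<open>z m\<close> can be merged into one \<open>p\<close>-summable sequence.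
\<close>

section \<open>Conjugate exponents and bounded linearity of complex scaling\<close>

lemma conj_exponent_gt_1:
  fixes p :: real
  assumes "1 < p"
  shows "1 < p / (p - 1)"
  using assms by (simp add: field_simps)

lemma bounded_linear_scaleC_right: "bounded_linear (\<lambda>x::'a::complex_normed_vector. c *\<^sub>C x)"
proof (rule bounded_linear_intro)
  fix r :: real and x :: 'a
  show "c *\<^sub>C (r *\<^sub>R x) = r *\<^sub>R (c *\<^sub>C x)"
    by (simp add: scaleC_scaleC mult.commute flip: scaleC_of_real)
next
  show "norm (c *\<^sub>C x) \<le> norm x * cmod c" for x :: 'a
    by (simp add: norm_scaleC mult.commute)
qed (simp add: scaleC_add_right)

lemma bounded_linear_scaleC_left: "bounded_linear (\<lambda>c. c *\<^sub>C (x::'a::complex_normed_vector))"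
proof (rule bounded_linear_intro)
  fix r :: real and c :: complex
  show "(r *\<^sub>R c) *\<^sub>C x = r *\<^sub>R (c *\<^sub>C x)"
    by (simp add: scaleR_conv_of_real flip: scaleC_of_real scaleC_scaleC)
next
  show "norm (c *\<^sub>C x) \<le> norm c * norm x" for c
    by (simp add: norm_scaleC)
qed (simp add: scaleC_add_left)

lemma scaleC_zero_left [simp]: "0 *\<^sub>C (x::'a::complex_normed_vector) = 0"
  by (rule linear_0[OF bounded_linear.linear[OF bounded_linear_scaleC_left]])

lemma scaleC_one [simp]: "1 *\<^sub>C (x::'a::complex_normed_vector) = x"
  using scaleC_of_real[of 1 x] by simp


section \<open>The dual unit ball and its action on \<open>p\<close>-summable sequences\<close>

lemma conj_lp_ball_1: "conj_lp_ball 1 = {\<alpha>. \<forall>n. cmod (\<alpha> n) \<le> 1}"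
  by (simp add: conj_lp_ball_def)

text \<open>Trades summability and the outer root for bounds on finite sums. Each such bound
  involves finitely many coordinates, so it survives coordinatewise limits.\<close>

lemma conj_lp_ball_iff:
  assumes "1 < p"
  shows "\<alpha> \<in> conj_lp_ball p \<longleftrightarrow>
    (\<forall>F. finite F \<longrightarrow> (\<Sum>n\<in>F. cmod (\<alpha> n) powr (p / (p - 1))) \<le> 1)"
proof -
  define q where "q = p / (p - 1)"
  have q: "1 < q"
    using conj_exponent_gt_1[OF assms] by (simp add: q_def)
  define g where "g n = cmod (\<alpha> n) powr q" for n
  have "(summable g \<and> (\<Sum>n. g n) powr (1/q) \<le> 1) \<longleftrightarrow> (\<forall>F. finite F \<longrightarrow> sum g F \<le> 1)"
  proof safe
    fix F :: "nat set"
    assume g: "summable g" "(\<Sum>n. g n) powr (1/q) \<le> 1" "finite F"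
    have "sum g F \<le> (\<Sum>n. g n)"
      using g by (intro sum_le_suminf) (auto simp: g_def)
    moreover have "(\<Sum>n. g n) \<le> 1"
    proof (rule ccontr)
      assume "\<not> (\<Sum>n. g n) \<le> 1"
      then have "1 powr (1/q) < (\<Sum>n. g n) powr (1/q)"
        using q by (intro powr_less_mono2) auto
      then show False
        using g by simp
    qed
    ultimately show "sum g F \<le> 1"
      by simp
  next
    assume le: "\<forall>F. finite F \<longrightarrow> sum g F \<le> 1"
    show s: "summable g"
      using le by (intro summableI_nonneg_bounded[where x=1]) (auto simp: g_def)
    have "0 \<le> (\<Sum>n. g n)"
      by (rule suminf_nonneg[OF s]) (simp add: g_def)
    moreover have "(\<Sum>n. g n) \<le> 1"
      using le by (intro suminf_le_const[OF s]) simp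
    ultimately have "(\<Sum>n. g n) powr (1/q) \<le> 1 powr (1/q)"
      using q by (intro powr_mono2) auto
    then show "(\<Sum>n. g n) powr (1/q) \<le> 1"
      by simp
  qed
  then show ?thesis
    using assms by (simp add: conj_lp_ball_def lp_seqs_def lp_norm_def q_def g_def[abs_def])
qed

lemma conj_lp_ball_cmod_le_1:
  assumes "1 \<le> p" "\<alpha> \<in> conj_lp_ball p"
  shows "cmod (\<alpha> n) \<le> 1"
proof (cases "p = 1")
  case False
  then have p: "1 < p"
    using assms by simp
  have "cmod (\<alpha> n) powr (p / (p - 1)) \<le> 1"
    using assms conj_lp_ball_iff[OF p, of \<alpha>] by (auto dest: spec[of _ "{n}"])
  then show ?thesis
    using conj_exponent_gt_1[OF p] powr_less_mono2[of "p / (p - 1)" 1 "cmod (\<alpha> n)"]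
    by (smt (verit) powr_one_eq_one)
qed (use assms in \<open>simp add: conj_lp_ball_1\<close>)

lemma conj_lp_ball_mult:
  assumes "1 \<le> p" "\<alpha> \<in> conj_lp_ball p" "cmod c \<le> 1"
  shows "(\<lambda>n. c * \<alpha> n) \<in> conj_lp_ball p"
proof -
  have *: "cmod (c * \<alpha> n) \<le> cmod (\<alpha> n)" for n
    using assms by (simp add: norm_mult mult_left_le_one_le)
  show ?thesis
  proof (cases "p = 1")
    case True
    then show ?thesis
      using assms * by (auto simp: conj_lp_ball_1 intro: order_trans)
  next
    case False
    then have p: "1 < p"
      using assms by simp
    have "(\<Sum>n\<in>F. cmod (c * \<alpha> n) powr (p / (p - 1))) \<le> (\<Sum>n\<in>F. cmod (\<alpha> n) powr (p / (p - 1)))" for F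
      using * p by (intro sum_mono powr_mono2) auto
    then show ?thesis
      using assms p by (auto simp: conj_lp_ball_iff intro: order_trans)
  qed
qed

text \<open>For positive \<open>a\<close> and \<open>b\<close> this is convexity of the power
  function; if one of them is zero, it reduces to \<open>w powr q \<le> w\<close> for
  \<open>w\<close> in [0, 1].\<close>

lemma powr_convex_comb_le:
  fixes q u v a b :: real
  assumes "1 \<le> q" "0 \<le> u" "0 \<le> v" "u + v = 1" "0 \<le> a" "0 \<le> b"
  shows "(u * a + v * b) powr q \<le> u * a powr q + v * b powr q"
proof -
  have *: "(w * c) powr q \<le> w * c powr q" if "0 \<le> w" "w \<le> 1" "0 \<le> c" for w c :: real
  proof -
    have "w powr q \<le> w"
      using that assms powr_mono'[of 1 q w] by simp
    then show ?thesis
      using that by (simp add: powr_mult mult_right_mono)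
  qed
  have u: "u = 1 - v"
    using assms by simp
  consider "a = 0" | "b = 0" | "0 < a" "0 < b"
    using assms by fastforce
  then show ?thesis
  proof cases
    case 3
    then show ?thesis
      using convex_onD[OF powr_convex[OF assms(1)], of v a b] assms
      by (simp add: u)
  qed (use assms *[of u a] *[of v b] in auto)
qed

text \<open>Convexity of the \<open>q\<close>-th power, applied in each coordinate and then summed,
  takes the place of Minkowski's inequality.\<close>

lemma conj_lp_ball_convex_comb:
  fixes u v :: real
  assumes "1 \<le> p" "\<alpha> \<in> conj_lp_ball p" "\<beta> \<in> conj_lp_ball p" "0 \<le> u" "0 \<le> v" "u + v = 1"
  shows "(\<lambda>n. of_real u * \<alpha> n + of_real v * \<beta> n) \<in> conj_lp_ball p"
proof -
  have *: "cmod (of_real u * \<alpha> n + of_real v * \<beta> n) \<le> u * cmod (\<alpha> n) + v * cmod (\<beta> n)" for n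
    using norm_triangle_ineq[of "of_real u * \<alpha> n" "of_real v * \<beta> n"] assms
    by (simp add: norm_mult)
  show ?thesis
  proof (cases "p = 1")
    case True
    have "u * cmod (\<alpha> n) + v * cmod (\<beta> n) \<le> 1" for n
      using assms True by (intro convex_bound_le) (auto simp: conj_lp_ball_1)
    then show ?thesis
      unfolding True conj_lp_ball_1 using * order_trans by blast
  next
    case False
    then have p: "1 < p"
      using assms by simp
    define q where "q = p / (p - 1)"
    have q: "1 < q"
      using conj_exponent_gt_1[OF p] by (simp add: q_def)
    show ?thesis
      unfolding conj_lp_ball_iff[OF p] q_def[symmetric]
    proof (intro allI impI)
      fix F :: "nat set"
      assume F: "finite F"
      have "(\<Sum>n\<in>F. cmod (of_real u * \<alpha> n + of_real v * \<beta> n) powr q)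
          \<le> (\<Sum>n\<in>F. u * cmod (\<alpha> n) powr q + v * cmod (\<beta> n) powr q)"
      proof (rule sum_mono)
        fix n
        have "cmod (of_real u * \<alpha> n + of_real v * \<beta> n) powr q
            \<le> (u * cmod (\<alpha> n) + v * cmod (\<beta> n)) powr q"
          using * q by (intro powr_mono2) auto
        also have "\<dots> \<le> u * cmod (\<alpha> n) powr q + v * cmod (\<beta> n) powr q"
          using assms q by (intro powr_convex_comb_le) auto
        finally show "cmod (of_real u * \<alpha> n + of_real v * \<beta> n) powr q
            \<le> u * cmod (\<alpha> n) powr q + v * cmod (\<beta> n) powr q" .
      qed
      also have "\<dots> = u * (\<Sum>n\<in>F. cmod (\<alpha> n) powr q) + v * (\<Sum>n\<in>F. cmod (\<beta> n) powr q)"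
        by (simp add: sum.distrib sum_distrib_left)
      also have "\<dots> \<le> 1"
        using assms F unfolding conj_lp_ball_iff[OF p] q_def[symmetric]
        by (intro convex_bound_le) auto
      finally show "(\<Sum>n\<in>F. cmod (of_real u * \<alpha> n + of_real v * \<beta> n) powr q) \<le> 1" .
    qed
  qed
qed

text \<open>Tychonoff: sequences carry the product topology, and the product \<open>D\<close> of
  closed unit discs is compact. For \<open>p = 1\<close> the ball is \<open>D\<close>; for
  \<open>1 < p\<close> it is cut out of \<open>D\<close> by one closed condition for each finite
  \<open>F\<close>.\<close>

lemma compact_conj_lp_ball:
  assumes "1 \<le> p"
  shows "compact (conj_lp_ball p)"
proof -
  define D where "D = (PiE UNIV (\<lambda>_::nat. cball (0::complex) 1))"
  have D: "compact D"
    unfolding D_def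
    using compactin_PiE[of "\<lambda>_. euclidean" UNIV "\<lambda>_::nat. cball (0::complex) 1"]
    by (simp add: euclidean_product_topology)
  show ?thesis
  proof (cases "p = 1")
    case True
    then have "conj_lp_ball p = D"
      by (auto simp: conj_lp_ball_1 D_def PiE_def Pi_def)
    then show ?thesis
      using D by simp
  next
    case False
    then have p: "1 < p"
      using assms by simp
    define q where "q = p / (p - 1)"
    have q: "1 < q"
      using conj_exponent_gt_1[OF p] by (simp add: q_def)
    have cl: "closed {\<alpha>. (\<Sum>n\<in>F. cmod (\<alpha> n) powr q) \<le> 1}" if "finite F" for F :: "nat set"
      using q
      by (intro closed_Collect_le continuous_intros continuous_on_powr'
          continuous_on_product_coordinates) auto
    have "conj_lp_ball p = D \<inter> (\<Inter>F\<in>Collect finite. {\<alpha>. (\<Sum>n\<in>F. cmod (\<alpha> n) powr q) \<le> 1})"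
      using conj_lp_ball_cmod_le_1[OF assms] unfolding q_def
      by (auto simp: D_def conj_lp_ball_iff[OF p] PiE_def Pi_def)
    then show ?thesis
      using D cl by (auto intro!: compact_Int_closed closed_INT)
  qed
qed

text \<open>Stands in for Hoelder's inequality: Young's inequality with a free parameter \<open>\<delta>\<close> yields
  summability as well as tails that are small uniformly in \<open>\<alpha>\<close>.\<close>

lemma conj_lp_ball_pairing_bound:
  assumes "1 \<le> p" "0 < \<delta>"
  shows "\<exists>C\<ge>0. \<forall>\<alpha>\<in>conj_lp_ball p. \<forall>y F. finite F \<longrightarrow>
    (\<Sum>n\<in>F. norm (\<alpha> n *\<^sub>C (y n :: 'a::complex_normed_vector)))
      \<le> \<delta> + C * (\<Sum>n\<in>F. norm (y n) powr p)"
proof (cases "p = 1")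
  case True
  show ?thesis
  proof (intro exI[of _ 1] conjI ballI allI impI)
    fix \<alpha> and y :: "nat \<Rightarrow> 'a" and F :: "nat set"
    assume "\<alpha> \<in> conj_lp_ball p"
    then have "(\<Sum>n\<in>F. norm (\<alpha> n *\<^sub>C (y n :: 'a))) \<le> (\<Sum>n\<in>F. norm (y n))"
      unfolding True conj_lp_ball_1 by (auto intro!: sum_mono mult_left_le_one_le simp: norm_scaleC)
    then show "(\<Sum>n\<in>F. norm (\<alpha> n *\<^sub>C (y n :: 'a))) \<le> \<delta> + 1 * (\<Sum>n\<in>F. norm (y n) powr p)"
      using assms by (simp add: True)
  qed simp
next
  case False
  then have p: "1 < p"
    using assms by simp
  define q where "q = p / (p - 1)"
  have q: "1 < q"
    using conj_exponent_gt_1[OF p] by (simp add: q_def)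
  have pq: "1 / q + 1 / p = 1"
    using p by (simp add: q_def field_simps)
  \<comment> \<open>Young's inequality is applied with the coefficient multiplied and the vector
    divided by \<open>s\<close>: the coefficients then contribute at most
    \<open>s powr q = \<delta>\<close>, and the vectors get the factor
    \<open>(1 / s) powr p\<close>, which depends on neither sequence.\<close>
  define s where "s = \<delta> powr (1/q)"
  have s: "0 < s" "s powr q = \<delta>"
    using assms q by (auto simp: s_def powr_powr)
  show ?thesis
  proof (intro exI[of _ "(1 / s) powr p"] conjI ballI allI impI)
    fix \<alpha> and y :: "nat \<Rightarrow> 'a" and F :: "nat set"
    assume \<alpha>: "\<alpha> \<in> conj_lp_ball p" and F: "finite F"
    have "norm (\<alpha> n *\<^sub>C y n) \<le> \<delta> * cmod (\<alpha> n) powr q + (1 / s) powr p * norm (y n) powr p" for n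
    proof -
      have "norm (\<alpha> n *\<^sub>C y n) = (s * cmod (\<alpha> n)) * (1 / s * norm (y n))"
        using s by (simp add: norm_scaleC)
      also have "\<dots> \<le> (s * cmod (\<alpha> n)) powr q / q + (1 / s * norm (y n)) powr p / p"
        using p q pq s by (intro Youngs_inequality) auto
      also have "\<dots> \<le> (s * cmod (\<alpha> n)) powr q / 1 + (1 / s * norm (y n)) powr p / 1"
        using p q by (intro add_mono divide_left_mono) auto
      also have "\<dots> = \<delta> * cmod (\<alpha> n) powr q + (1 / s) powr p * norm (y n) powr p"
        using s by (simp add: powr_mult powr_divide)
      finally show ?thesis .
    qed
    then have "(\<Sum>n\<in>F. norm (\<alpha> n *\<^sub>C y n))
        \<le> (\<Sum>n\<in>F. \<delta> * cmod (\<alpha> n) powr q + (1 / s) powr p * norm (y n) powr p)"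
      by (intro sum_mono)
    also have "\<dots> = \<delta> * (\<Sum>n\<in>F. cmod (\<alpha> n) powr q) + (1 / s) powr p * (\<Sum>n\<in>F. norm (y n) powr p)"
      by (simp add: sum.distrib sum_distrib_left)
    also have "\<dots> \<le> \<delta> * 1 + (1 / s) powr p * (\<Sum>n\<in>F. norm (y n) powr p)"
      using \<alpha> F assms by (intro add_mono mult_left_mono) (auto simp: conj_lp_ball_iff[OF p] q_def)
    finally show "(\<Sum>n\<in>F. norm (\<alpha> n *\<^sub>C y n))
        \<le> \<delta> + (1 / s) powr p * (\<Sum>n\<in>F. norm (y n) powr p)"
      by simp
  qed simp
qed

lemma summable_norm_pairing:
  assumes "1 \<le> p" "\<alpha> \<in> conj_lp_ball p" "y \<in> lp_seqs p"
  shows "summable (\<lambda>n. norm (\<alpha> n *\<^sub>C (y n :: 'a::complex_normed_vector)))"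
proof -
  obtain C where C: "0 \<le> C" "\<forall>\<alpha>\<in>conj_lp_ball p. \<forall>y F. finite F \<longrightarrow>
      (\<Sum>n\<in>F. norm (\<alpha> n *\<^sub>C (y n :: 'a))) \<le> 1 + C * (\<Sum>n\<in>F. norm (y n) powr p)"
    using conj_lp_ball_pairing_bound[OF assms(1) zero_less_one, where ?'a = 'a] by blast
  have y: "summable (\<lambda>n. norm (y n) powr p)"
    using assms by (simp add: lp_seqs_def)
  show ?thesis
  proof (rule summableI_nonneg_bounded)
    fix N
    have "(\<Sum>n<N. norm (\<alpha> n *\<^sub>C y n)) \<le> 1 + C * (\<Sum>n<N. norm (y n) powr p)"
      using C assms by blast
    also have "\<dots> \<le> 1 + C * (\<Sum>n. norm (y n) powr p)"
      using C(1) y by (intro add_left_mono mult_left_mono sum_le_suminf) auto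
    finally show "(\<Sum>n<N. norm (\<alpha> n *\<^sub>C y n)) \<le> 1 + C * (\<Sum>n. norm (y n) powr p)" .
  qed simp
qed

lemma sums_pairing:
  assumes "1 \<le> p" "\<alpha> \<in> conj_lp_ball p" "y \<in> lp_seqs p"
  shows "(\<lambda>n. \<alpha> n *\<^sub>C (y n :: 'a::complex_banach)) sums (\<Sum>n. \<alpha> n *\<^sub>C y n)"
  by (rule summable_sums[OF summable_norm_cancel[OF summable_norm_pairing[OF assms]]])


section \<open>The sets \<open>p_co\<close>\<close>

lemma p_coE:
  assumes "v \<in> p_co p y" "1 \<le> p" "y \<in> lp_seqs p"
  obtains \<alpha> where "\<alpha> \<in> conj_lp_ball p" "(\<lambda>n. \<alpha> n *\<^sub>C y n) sums v"
proof -
  obtain \<alpha> where "\<alpha> \<in> conj_lp_ball p" "v = (\<Sum>n. \<alpha> n *\<^sub>C y n)"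
    using assms(1) unfolding p_co_def by blast
  then show thesis
    using sums_pairing[OF assms(2) _ assms(3)] by (intro that) simp_all
qed

lemma p_coI:
  assumes "\<alpha> \<in> conj_lp_ball p" "(\<lambda>n. \<alpha> n *\<^sub>C y n) sums v"
  shows "v \<in> p_co p y"
  using assms unfolding p_co_def by (auto simp: sums_iff)

text \<open>The constant \<open>C\<close> of the pairing bound depends on \<open>p\<close> and
  \<open>\<delta>\<close> alone, so an \<open>N\<close> that makes the tail of the
  \<open>p\<close>-th powers of \<open>y\<close> small works for all coefficient sequences in the
  ball.\<close>

lemma uniform_limit_pairing:
  assumes p: "1 \<le> p" and y: "y \<in> lp_seqs p"
  shows "uniform_limit (conj_lp_ball p)
    (\<lambda>N \<alpha>. \<Sum>n<N. \<alpha> n *\<^sub>C (y n :: 'a::complex_banach)) (\<lambda>\<alpha>. \<Sum>n. \<alpha> n *\<^sub>C y n) sequentially"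
proof (rule uniform_limitI)
  fix e :: real
  assume e: "0 < e"
  obtain C where C: "0 \<le> C" "\<forall>\<alpha>\<in>conj_lp_ball p. \<forall>y F. finite F \<longrightarrow>
      (\<Sum>n\<in>F. norm (\<alpha> n *\<^sub>C (y n :: 'a))) \<le> e / 3 + C * (\<Sum>n\<in>F. norm (y n) powr p)"
    using conj_lp_ball_pairing_bound[OF p divide_pos_pos[OF e zero_less_numeral], where ?'a = 'a] by blast
  define g where "g n = norm (y n) powr p" for n
  have g: "summable g"
    using y by (simp add: lp_seqs_def g_def[abs_def])
  \<comment> \<open>Using \<open>C + 1\<close> keeps the denominator positive when \<open>C\<close>
    is 0. Each of the two terms of the bound is then at most \<open>e / 3\<close>.\<close>
  have "0 < e / (3 * (C + 1))"
    using e C(1) by simp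
  then obtain N where N: "\<And>m n. N \<le> m \<Longrightarrow> norm (sum g {m..<n}) < e / (3 * (C + 1))"
    using g unfolding summable_Cauchy by blast
  have "dist (\<Sum>n<M. \<alpha> n *\<^sub>C y n) (\<Sum>n. \<alpha> n *\<^sub>C y n) < e"
    if \<alpha>: "\<alpha> \<in> conj_lp_ball p" and M: "N \<le> M" for M \<alpha>
  proof -
    \<comment> \<open>The estimate is proved for finite blocks and passed to the limit;
      \<open>2 / 3 * e\<close> leaves room for the strict inequality.\<close>
    have lim: "(\<lambda>L. dist (\<Sum>n<M. \<alpha> n *\<^sub>C y n) (\<Sum>n<L. \<alpha> n *\<^sub>C y n))
        \<longlonglongrightarrow> dist (\<Sum>n<M. \<alpha> n *\<^sub>C y n) (\<Sum>n. \<alpha> n *\<^sub>C y n)"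
      using sums_pairing[OF p \<alpha> y] unfolding sums_def by (intro tendsto_intros)
    have "dist (\<Sum>n<M. \<alpha> n *\<^sub>C y n) (\<Sum>n<L. \<alpha> n *\<^sub>C y n) \<le> 2 / 3 * e" if L: "M \<le> L" for L
    proof -
      have "dist (\<Sum>n<M. \<alpha> n *\<^sub>C y n) (\<Sum>n<L. \<alpha> n *\<^sub>C y n) = norm (\<Sum>n\<in>{M..<L}. \<alpha> n *\<^sub>C y n)"
        using sum_diff_nat_ivl[of 0 M L "\<lambda>n. \<alpha> n *\<^sub>C y n"] L
        by (simp add: dist_norm norm_minus_commute lessThan_atLeast0)
      also have "\<dots> \<le> (\<Sum>n\<in>{M..<L}. norm (\<alpha> n *\<^sub>C y n))"
        by (rule norm_sum)
      also have "\<dots> \<le> e / 3 + C * sum g {M..<L}"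
        using C(2) \<alpha> unfolding g_def by simp
      also have "\<dots> \<le> e / 3 + (C + 1) * (e / (3 * (C + 1)))"
        using N[OF M, of L] C(1) by (intro add_left_mono mult_mono) (auto simp: g_def sum_nonneg)
      also have "\<dots> = 2 / 3 * e"
        using C(1) by (simp add: field_simps)
      finally show ?thesis .
    qed
    then have "dist (\<Sum>n<M. \<alpha> n *\<^sub>C y n) (\<Sum>n. \<alpha> n *\<^sub>C y n) \<le> 2 / 3 * e"
      by (intro LIMSEQ_le_const2[OF lim]) blast
    also have "\<dots> < e"
      using e by simp
    finally show ?thesis .
  qed
  then show "\<forall>\<^sub>F M in sequentially. \<forall>\<alpha>\<in>conj_lp_ball p.
      dist (\<Sum>n<M. \<alpha> n *\<^sub>C y n) (\<Sum>n. \<alpha> n *\<^sub>C y n) < e"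
    unfolding eventually_sequentially by blast
qed

lemma compact_p_co:
  assumes "1 \<le> p" "y \<in> lp_seqs p"
  shows "compact (p_co p y)"
  unfolding p_co_def
proof (rule compact_continuous_image)
  have "continuous_on UNIV (\<lambda>\<alpha>::nat \<Rightarrow> complex. \<Sum>n<N. \<alpha> n *\<^sub>C y n)" for N
    by (intro continuous_on_sum bounded_linear.continuous_on[OF bounded_linear_scaleC_left]
        continuous_on_product_coordinates)
  then show "continuous_on (conj_lp_ball p) (\<lambda>\<alpha>. \<Sum>n. \<alpha> n *\<^sub>C y n)"
    by (intro uniform_limit_theorem[OF _ uniform_limit_pairing[OF assms]] always_eventually)
      (auto intro: continuous_on_subset)
qed (rule compact_conj_lp_ball[OF assms(1)])

text \<open>Reconciles \<open>rel_p_compact\<close>, which is stated with the closure, with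
  \<open>m_p\<close>, which asks for inclusion in \<open>p_co p y\<close> itself.\<close>

lemma closure_p_co [simp]: "1 \<le> p \<Longrightarrow> y \<in> lp_seqs p \<Longrightarrow> closure (p_co p y) = p_co p y"
  by (intro closure_closed compact_imp_closed compact_p_co)

lemma convex_p_co:
  assumes "1 \<le> p" "y \<in> lp_seqs p"
  shows "convex (p_co p y)"
proof (rule convexI)
  fix v w :: 'a and s t :: real
  assume vw: "v \<in> p_co p y" "w \<in> p_co p y" and st: "0 \<le> s" "0 \<le> t" "s + t = 1"
  obtain \<alpha> \<beta> where \<alpha>: "\<alpha> \<in> conj_lp_ball p" "(\<lambda>n. \<alpha> n *\<^sub>C y n) sums v"
    and \<beta>: "\<beta> \<in> conj_lp_ball p" "(\<lambda>n. \<beta> n *\<^sub>C y n) sums w"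
    using vw[THEN p_coE, OF assms] by metis
  have "(\<lambda>n. s *\<^sub>R (\<alpha> n *\<^sub>C y n) + t *\<^sub>R (\<beta> n *\<^sub>C y n)) sums (s *\<^sub>R v + t *\<^sub>R w)"
    using \<alpha> \<beta> by (intro sums_add bounded_linear.sums[OF bounded_linear_scaleR_right])
  then have "(\<lambda>n. (of_real s * \<alpha> n + of_real t * \<beta> n) *\<^sub>C y n) sums (s *\<^sub>R v + t *\<^sub>R w)"
    by (simp add: scaleC_add_left flip: scaleC_of_real scaleC_scaleC)
  from p_coI[OF conj_lp_ball_convex_comb[OF assms(1) \<alpha>(1) \<beta>(1) st] this]
  show "s *\<^sub>R v + t *\<^sub>R w \<in> p_co p y" .
qed

lemma p_co_balanced:
  assumes "1 \<le> p" "y \<in> lp_seqs p" "v \<in> p_co p y" "cmod c \<le> 1"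
  shows "c *\<^sub>C v \<in> p_co p y"
proof -
  obtain \<alpha> where \<alpha>: "\<alpha> \<in> conj_lp_ball p" "(\<lambda>n. \<alpha> n *\<^sub>C y n) sums v"
    using assms(3,1,2) by (rule p_coE)
  have "(\<lambda>n. (c * \<alpha> n) *\<^sub>C y n) sums (c *\<^sub>C v)"
    using bounded_linear.sums[OF bounded_linear_scaleC_right \<alpha>(2), of c] by (simp add: scaleC_scaleC)
  from p_coI[OF conj_lp_ball_mult[OF assms(1) \<alpha>(1) assms(4)] this] show ?thesis .
qed

lemma p_co_scaleR:
  assumes "1 \<le> p" "y \<in> lp_seqs p" "v \<in> p_co p y"
  shows "c *\<^sub>R v \<in> p_co p (\<lambda>n. c *\<^sub>R y n)"
proof -
  obtain \<alpha> where \<alpha>: "\<alpha> \<in> conj_lp_ball p" "(\<lambda>n. \<alpha> n *\<^sub>C y n) sums v"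
    using assms(3,1,2) by (rule p_coE)
  have "(\<lambda>n. c *\<^sub>R (\<alpha> n *\<^sub>C y n)) sums (c *\<^sub>R v)"
    by (rule bounded_linear.sums[OF bounded_linear_scaleR_right \<alpha>(2)])
  then have "(\<lambda>n. \<alpha> n *\<^sub>C (c *\<^sub>R y n)) sums (c *\<^sub>R v)"
    by (simp add: scaleC_scaleC mult.commute flip: scaleC_of_real)
  then show ?thesis
    using \<alpha> by (intro p_coI)
qed

lemma lp_seqs_scaleR: "y \<in> lp_seqs p \<Longrightarrow> (\<lambda>n. c *\<^sub>R y n) \<in> lp_seqs p"
  unfolding lp_seqs_def by (simp add: powr_mult summable_mult)

lemma lp_norm_nonneg: "0 \<le> lp_norm p y"
  by (simp add: lp_norm_def)

lemma lp_norm_scaleR: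
  assumes "1 \<le> p" "y \<in> lp_seqs p"
  shows "lp_norm p (\<lambda>n. c *\<^sub>R y n) = \<bar>c\<bar> * lp_norm p y"
proof -
  have y: "summable (\<lambda>n. norm (y n) powr p)"
    using assms by (simp add: lp_seqs_def)
  have "(\<Sum>n. norm (c *\<^sub>R y n) powr p) = \<bar>c\<bar> powr p * (\<Sum>n. norm (y n) powr p)"
    by (simp add: powr_mult suminf_mult[OF y])
  moreover have "0 \<le> (\<Sum>n. norm (y n) powr p)"
    using y by (intro suminf_nonneg) auto
  ultimately show ?thesis
    using assms by (simp add: lp_norm_def powr_mult powr_powr)
qed

lemma lp_norm_powr:
  assumes "1 \<le> p" "y \<in> lp_seqs p"
  shows "lp_norm p y powr p = (\<Sum>n. norm (y n) powr p)"
proof -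
  have "0 \<le> (\<Sum>n. norm (y n) powr p)"
    using assms by (intro suminf_nonneg) (auto simp: lp_seqs_def)
  then show ?thesis
    using assms by (simp add: lp_norm_def powr_powr)
qed


section \<open>Merging countably many generating sequences\<close>

text \<open>A finite set of codes decodes into a finite rectangle, which can be summed row by row.
  This serves both the \<open>p\<close>-th powers of the merged vectors and the \<open>q\<close>-th
  powers of the merged coefficients.\<close>

lemma sum_prod_decode_le:
  fixes g :: "nat \<times> nat \<Rightarrow> real"
  assumes nonneg: "\<And>x. 0 \<le> g x"
    and b: "\<And>m G. finite G \<Longrightarrow> (\<Sum>n\<in>G. g (m, n)) \<le> b m"
    and B: "\<And>M. (\<Sum>m<M. b m) \<le> B"
    and "finite F"
  shows "(\<Sum>k\<in>F. g (prod_decode k)) \<le> B"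
proof -
  define S where "S = prod_decode ` F"
  have S: "finite S"
    using \<open>finite F\<close> by (simp add: S_def)
  obtain M where M: "\<forall>m\<in>fst ` S. m < M"
    using S finite_nat_set_iff_bounded by (metis finite_imageI)
  have "(\<Sum>k\<in>F. g (prod_decode k)) = sum g S"
    by (simp add: S_def sum.reindex inj_prod_decode)
  also have "\<dots> \<le> sum g ({..<M} \<times> snd ` S)"
    using S M nonneg by (intro sum_mono2) (force simp: image_iff)+
  also have "\<dots> = (\<Sum>m<M. \<Sum>n\<in>snd ` S. g (m, n))"
    by (simp add: sum.cartesian_product)
  also have "\<dots> \<le> (\<Sum>m<M. b m)"
    using S b by (intro sum_mono) simp
  finally show ?thesis
    using B order_trans by blast
qed

lemma sum_half_power_le: "(\<Sum>m<M. (1/2::real) ^ m) \<le> 2"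
  using sum_le_suminf[OF summable_geometric[of "1/2::real"], of "{..<M}"]
  by (simp add: suminf_geometric)

text \<open>The countably many generating sequences are merged into a single one along
  \<open>prod_decode\<close>; the factors \<open>2 ^ (m + 1)\<close> are moved from the coefficients to the vectors
  so that the merged coefficients still lie in the unit ball.\<close>

lemma p_co_sums:
  fixes z :: "nat \<Rightarrow> nat \<Rightarrow> 'f::complex_banach"
  assumes p: "1 \<le> p" and z: "\<And>m. z m \<in> lp_seqs p" and zD: "\<And>m. lp_norm p (z m) \<le> D / 4 ^ m"
  shows "\<exists>w\<in>lp_seqs p. \<forall>v s. (\<forall>m. v m \<in> p_co p (z m)) \<longrightarrow> v sums s \<longrightarrow> s \<in> p_co p w"
proof -
  \<comment> \<open>The factor \<open>2 ^ (m + 1)\<close> weakens the decay from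
    \<open>D / 4 ^ m\<close> to \<open>2 * D * (1/2) ^ m\<close>, whose \<open>p\<close>-th powers
    are still summable. Since \<open>w\<close> is built from \<open>z\<close> alone, it serves all
    \<open>v\<close> and \<open>s\<close> at once.\<close>
  define zz where "zz m n = (2::real) ^ (m + 1) *\<^sub>R z m n" for m n
  define w where "w k = (case prod_decode k of (m, n) \<Rightarrow> zz m n)" for k
  have D: "0 \<le> D"
    using zD[of 0] lp_norm_nonneg[of p "z 0"] by simp
  have zz: "zz m \<in> lp_seqs p" for m
    unfolding zz_def by (rule lp_seqs_scaleR[OF z])
  have zzD: "lp_norm p (zz m) \<le> 2 * D * (1/2) ^ m" for m
  proof -
    have "lp_norm p (zz m) = 2 ^ (m + 1) * lp_norm p (z m)"
      unfolding zz_def by (subst lp_norm_scaleR[OF p z]) simp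
    also have "\<dots> \<le> 2 ^ (m + 1) * (D / 4 ^ m)"
      using zD by (intro mult_left_mono) auto
    also have "\<dots> = 2 * D * (2 ^ m / 4 ^ m)"
      by simp
    also have "(2::real) ^ m / 4 ^ m = (1/2) ^ m"
      by (simp flip: power_divide)
    finally show ?thesis .
  qed
  have w: "w \<in> lp_seqs p"
    unfolding lp_seqs_def mem_Collect_eq
  proof (rule summableI_nonneg_bounded)
    fix N
    have "(\<Sum>k<N. norm (case prod_decode k of (m, n) \<Rightarrow> zz m n) powr p) \<le> (2 * D) powr p * 2"
    proof (rule sum_prod_decode_le[where b = "\<lambda>m. (2 * D) powr p * (1/2) ^ m"])
      fix m and G :: "nat set"
      assume "finite G"
      then have "(\<Sum>n\<in>G. norm (zz m n) powr p) \<le> (\<Sum>n. norm (zz m n) powr p)"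
        using zz by (intro sum_le_suminf) (auto simp: lp_seqs_def)
      also have "\<dots> = lp_norm p (zz m) powr p"
        by (rule lp_norm_powr[OF p zz, symmetric])
      also have "\<dots> \<le> (2 * D * (1/2) ^ m) powr p"
        using p zzD lp_norm_nonneg by (intro powr_mono2) auto
      also have "\<dots> = (2 * D) powr p * ((1/2) ^ m) powr p"
        using D by (simp add: powr_mult)
      also have "\<dots> \<le> (2 * D) powr p * (1/2) ^ m"
        using p powr_mono'[of 1 p "(1/2) ^ m"] by (intro mult_left_mono) (auto simp: power_le_one)
      finally show "(\<Sum>n\<in>G. norm (case (m, n) of (m, n) \<Rightarrow> zz m n) powr p) \<le> (2 * D) powr p * (1/2) ^ m"
        by simp
    next
      show "(\<Sum>m<M. (2 * D) powr p * (1/2) ^ m) \<le> (2 * D) powr p * 2" for M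
        unfolding sum_distrib_left[symmetric] by (intro mult_left_mono sum_half_power_le) simp
    qed simp_all
    then show "(\<Sum>k<N. norm (w k) powr p) \<le> (2 * D) powr p * 2"
      by (simp add: w_def)
  qed simp
  moreover have "s \<in> p_co p w" if v: "\<forall>m. v m \<in> p_co p (z m)" and s: "v sums s" for v s
  proof -
    have "\<exists>\<alpha>. \<alpha> \<in> conj_lp_ball p \<and> (\<lambda>n. \<alpha> n *\<^sub>C z m n) sums v m" for m
    proof -
      obtain \<alpha> where "\<alpha> \<in> conj_lp_ball p" "(\<lambda>n. \<alpha> n *\<^sub>C z m n) sums v m"
        using v[rule_format, of m] p z by (rule p_coE)
      then show ?thesis
        by blast
    qed
    then obtain a where a: "\<And>m. a m \<in> conj_lp_ball p" "\<And>m. (\<lambda>n. a m n *\<^sub>C z m n) sums v m"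
      by metis
    \<comment> \<open>Row \<open>m\<close> is damped by \<open>(1/2) ^ (m + 1)\<close>, undoing the
      scaling of the vectors. With exponent \<open>m + 1\<close> rather than \<open>m\<close> the
      row weights add up to at most 1, which keeps the \<open>q\<close>-th power sums within the
      unit ball when \<open>1 < p\<close>.\<close>
    define \<alpha> where "\<alpha> k = (case prod_decode k of (m, n) \<Rightarrow> of_real ((1/2) ^ (m + 1)) * a m n)" for k
    have half: "(1/2::real) ^ (m + 1) \<le> 1" for m
      by (rule power_le_one) simp_all
    have \<alpha>: "\<alpha> \<in> conj_lp_ball p"
    proof (cases "p = 1")
      case True
      have "cmod (of_real ((1/2) ^ (m + 1)) * a m n) \<le> 1" for m n
        using a(1)[of m] half[of m] unfolding True conj_lp_ball_1 norm_mult norm_of_real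
        by (intro mult_le_one) (simp_all del: power_Suc)
      then have "cmod (\<alpha> k) \<le> 1" for k
        unfolding \<alpha>_def by (cases "prod_decode k") (simp only: prod.case)
      then show ?thesis
        unfolding True conj_lp_ball_1 by blast
    next
      case False
      then have p1: "1 < p"
        using p by simp
      define q where "q = p / (p - 1)"
      have q: "1 < q"
        using conj_exponent_gt_1[OF p1] by (simp add: q_def)
      show ?thesis
        unfolding conj_lp_ball_iff[OF p1] q_def[symmetric]
      proof (intro allI impI)
        fix F :: "nat set"
        assume "finite F"
        have "(\<Sum>k\<in>F. cmod (case prod_decode k of (m, n) \<Rightarrow> of_real ((1/2) ^ (m + 1)) * a m n) powr q) \<le> 1"
        proof (rule sum_prod_decode_le[where b = "\<lambda>m. (1/2) ^ (m + 1)"])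
          fix m and G :: "nat set"
          assume G: "finite G"
          have "(\<Sum>n\<in>G. cmod (of_real ((1/2) ^ (m + 1)) * a m n) powr q)
              = ((1/2) ^ (m + 1)) powr q * (\<Sum>n\<in>G. cmod (a m n) powr q)"
            unfolding norm_mult norm_of_real sum_distrib_left
            by (intro sum.cong refl) (simp add: powr_mult del: power_Suc)
          also have "\<dots> \<le> ((1/2) ^ (m + 1)) powr q * 1"
            using a(1)[of m] G unfolding conj_lp_ball_iff[OF p1] q_def[symmetric]
            by (intro mult_left_mono) auto
          also have "\<dots> \<le> (1/2) ^ (m + 1)"
            using q powr_mono'[of 1 q "(1/2) ^ (m + 1)"] half[of m] by (simp del: power_Suc)
          finally show "(\<Sum>n\<in>G. cmod (case (m, n) of (m, n) \<Rightarrow> of_real ((1/2) ^ (m + 1)) * a m n) powr q)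
              \<le> (1/2) ^ (m + 1)"
            by simp
        next
          show "(\<Sum>m<M. (1/2::real) ^ (m + 1)) \<le> 1" for M
            using sum_half_power_le[of M] by (simp flip: sum_divide_distrib)
        qed (use \<open>finite F\<close> in simp_all)
        then show "(\<Sum>k\<in>F. cmod (\<alpha> k) powr q) \<le> 1"
          by (simp add: \<alpha>_def)
      qed
    qed
    \<comment> \<open>Absolute convergence allows the merged series to be summed by rows. Row
      \<open>m\<close> has sum \<open>v m\<close>, so the total \<open>t\<close> is the sum
      \<open>s\<close> of the \<open>v m\<close>.\<close>
    define h where "h = (\<lambda>(m, n). a m n *\<^sub>C z m n)"
    define t where "t = (\<Sum>k. \<alpha> k *\<^sub>C w k)"
    have t: "(\<lambda>k. \<alpha> k *\<^sub>C w k) sums t"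
      unfolding t_def by (rule sums_pairing[OF p \<alpha> w])
    have "((\<lambda>k. \<alpha> k *\<^sub>C w k) has_sum t) UNIV"
      by (rule norm_summable_imp_has_sum[OF summable_norm_pairing[OF p \<alpha> w] t])
    moreover have "\<alpha> k *\<^sub>C w k = h (prod_decode k)" for k
    proof -
      obtain m n where k: "prod_decode k = (m, n)"
        by (cases "prod_decode k")
      have "\<alpha> k *\<^sub>C w k = (of_real ((1/2) ^ (m + 1)) * a m n * of_real (2 ^ (m + 1))) *\<^sub>C z m n"
        by (simp only: k \<alpha>_def w_def zz_def prod.case scaleC_scaleC flip: scaleC_of_real)
      also have "of_real ((1/2) ^ (m + 1)) * a m n * of_real (2 ^ (m + 1))
          = of_real ((1/2) ^ (m + 1) * 2 ^ (m + 1)) * a m n"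
        by (simp only: of_real_mult ac_simps)
      also have "(1/2) ^ (m + 1) * 2 ^ (m + 1) = (1::real)"
        by (simp flip: power_mult_distrib)
      finally show ?thesis
        by (simp add: k h_def)
    qed
    ultimately have "((h \<circ> prod_decode) has_sum t) UNIV"
      by (simp add: o_def)
    then have "(h has_sum t) (UNIV \<times> UNIV)"
      using has_sum_reindex[OF inj_prod_decode[of UNIV], of h t] by (simp add: surj_prod_decode)
    moreover have "((\<lambda>n. h (m, n)) has_sum v m) UNIV" for m
      unfolding h_def prod.case
      by (rule norm_summable_imp_has_sum[OF summable_norm_pairing[OF p a(1) z] a(2)])
    ultimately have "(v has_sum t) UNIV"
      by (rule has_sum_SigmaD)
    then have "s = t"
      using s has_sum_imp_sums sums_unique2 by blast
    then show ?thesis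
      using p_coI[OF \<alpha> t] by simp
  qed
  ultimately show ?thesis
    by blast
qed


section \<open>Cauchy's formula over roots of unity\<close>

text \<open>Orthogonality of characters: this is a geometric sum whose ratio
  \<open>\<omega> ^ l\<close> is an \<open>N\<close>-th root of unity, equal to 1 exactly when
  \<open>N\<close> divides \<open>l\<close>.\<close>

lemma sum_root_of_unity_power:
  assumes "0 < N"
  defines "\<omega> \<equiv> exp (2 * of_real pi * \<i> / of_nat N)"
  shows "(\<Sum>k<N. (\<omega> ^ k) ^ l) = (if N dvd l then of_nat N else 0)"
proof -
  have "\<omega> ^ l = exp (2 * of_real pi * \<i> * of_nat l / of_nat N)"
    unfolding \<omega>_def by (simp add: exp_of_nat_mult[symmetric] ac_simps)
  then have 1: "\<omega> ^ l = 1 \<longleftrightarrow> N dvd l"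
    using complex_root_unity_eq_1[of N l] assms(1) by simp
  have "\<omega> ^ N = 1"
    using complex_root_unity[of N 1] assms(1) by (simp add: \<omega>_def)
  then have N: "(\<omega> ^ l) ^ N = 1"
    by (simp add: power_mult[symmetric] mult.commute[of l N]) (simp add: power_mult)
  have "(\<Sum>k<N. (\<omega> ^ k) ^ l) = (\<Sum>k<N. (\<omega> ^ l) ^ k)"
    by (simp add: mult.commute flip: power_mult)
  then show ?thesis
    using 1 N by (simp add: sum_gp_strict)
qed

text \<open>The average over the \<open>N\<close>-th roots of unity \<open>u\<close> of
  \<open>u ^ (N - m)\<close> times the value at \<open>u\<close> lies in \<open>K\<close> and is the
  sum of all \<open>c j\<close> with \<open>j\<close> congruent to \<open>m\<close> modulo
  \<open>N\<close>. It differs from \<open>c m\<close> by at most a tail of the norms, and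
  \<open>K\<close> is closed.\<close>

lemma coeff_in_closed_convex_balanced:
  fixes c :: "nat \<Rightarrow> 'f::complex_banach"
  assumes K: "closed K" "convex K"
    and balanced: "\<And>v u. v \<in> K \<Longrightarrow> cmod u = 1 \<Longrightarrow> u *\<^sub>C v \<in> K"
    and c: "summable (\<lambda>j. norm (c j))"
    and vals: "\<And>u. cmod u = 1 \<Longrightarrow> \<exists>s\<in>K. (\<lambda>j. u ^ j *\<^sub>C c j) sums s"
  shows "c m \<in> K"
proof -
  obtain s where s: "\<And>u. cmod u = 1 \<Longrightarrow> s u \<in> K" "\<And>u. cmod u = 1 \<Longrightarrow> (\<lambda>j. u ^ j *\<^sub>C c j) sums s u"
    using vals by metis
  define \<omega> where "\<omega> N = exp (2 * of_real pi * \<i> / of_nat N)" for N :: nat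
  have \<omega>: "cmod (\<omega> N ^ k) = 1" for N k
    by (simp add: \<omega>_def norm_power norm_exp_eq_Re)
  \<comment> \<open>The exponent \<open>N - m\<close> plays the role of \<open>-m\<close>, since
    \<open>\<omega> N ^ N = 1\<close>. Subtraction of naturals is truncated, so the facts on
    \<open>v N\<close> assume \<open>m < N\<close>.\<close>
  define v where "v N = (\<Sum>k<N. (1 / real N) *\<^sub>R ((\<omega> N ^ k) ^ (N - m) *\<^sub>C s (\<omega> N ^ k)))" for N
  define T where "T N = (\<Sum>j. norm (c j)) - (\<Sum>j<N. norm (c j))" for N
  have vK: "v N \<in> K" if "m < N" for N
    unfolding v_def using that K s \<omega>
    by (intro convex_sum balanced) (auto simp: norm_power)
  have vT: "norm (v N - c m) \<le> T N" if N: "m < N" for N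
  proof -
    have "(\<lambda>j. \<Sum>k<N. (1 / real N) *\<^sub>R ((\<omega> N ^ k) ^ (N - m) *\<^sub>C ((\<omega> N ^ k) ^ j *\<^sub>C c j))) sums v N"
      unfolding v_def using s \<omega>
      by (intro sums_sum bounded_linear.sums[OF bounded_linear_scaleR_right]
          bounded_linear.sums[OF bounded_linear_scaleC_right]) auto
    moreover have "(\<Sum>k<N. (1 / real N) *\<^sub>R ((\<omega> N ^ k) ^ (N - m) *\<^sub>C ((\<omega> N ^ k) ^ j *\<^sub>C c j)))
        = (if N dvd N - m + j then c j else 0)" for j
    proof -
      have "(\<Sum>k<N. (1 / real N) *\<^sub>R ((\<omega> N ^ k) ^ (N - m) *\<^sub>C ((\<omega> N ^ k) ^ j *\<^sub>C c j)))
          = (1 / real N) *\<^sub>R (\<Sum>k<N. (\<omega> N ^ k) ^ (N - m + j) *\<^sub>C c j)"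
        by (simp add: scaleC_scaleC power_add scaleR_sum_right)
      also have "(\<Sum>k<N. (\<omega> N ^ k) ^ (N - m + j) *\<^sub>C c j) = (\<Sum>k<N. (\<omega> N ^ k) ^ (N - m + j)) *\<^sub>C c j"
        by (rule linear_sum[OF bounded_linear.linear[OF bounded_linear_scaleC_left], symmetric])
      also have "(1 / real N) *\<^sub>R \<dots> = (if N dvd N - m + j then c j else 0)"
        using N scaleC_of_real[of "real N" "c j"] sum_root_of_unity_power[of N "N - m + j"]
        unfolding \<omega>_def by simp
      finally show ?thesis .
    qed
    ultimately have "(\<lambda>j. if N dvd N - m + j then c j else 0) sums v N"
      by simp
    then have "(\<lambda>j. (if N dvd N - m + j then c j else 0) - (if j = m then c j else 0)) sums (v N - c m)"
      by (intro sums_diff sums_single)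
    moreover have "(\<lambda>j. norm (c j) - (if j \<in> {..<N} then norm (c j) else 0)) sums T N"
      unfolding T_def by (intro sums_diff summable_sums[OF c] sums_If_finite_set finite_lessThan)
    \<comment> \<open>Below \<open>N\<close> only \<open>j = m\<close> survives and is cancelled;
      from \<open>N\<close> on, the difference is \<open>c j\<close> or 0.\<close>
    moreover have "norm ((if N dvd N - m + j then c j else 0) - (if j = m then c j else 0))
        \<le> norm (c j) - (if j \<in> {..<N} then norm (c j) else 0)" for j
    proof (cases "j < N")
      case True
      \<comment> \<open>The number \<open>N - m + j\<close> lies strictly between 0 and
        \<open>2 * N\<close>, so the only multiple of \<open>N\<close> it can be is \<open>N\<close>
        itself.\<close>
      have "N dvd N - m + j \<longleftrightarrow> j = m"
      proof
        assume "N dvd N - m + j"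
        then obtain i where i: "N - m + j = N * i"
          by blast
        then have "0 < N * i" "N * i < N * 2"
          using N True by linarith+
        then have "i = 1"
          by simp
        then show "j = m"
          using i N by simp
      qed (use N in simp)
      then show ?thesis
        using True by simp
    next
      case False
      then show ?thesis
        using N by simp
    qed
    ultimately show ?thesis
      by (rule norm_sums_le)
  qed
  have "T \<longlonglongrightarrow> (\<Sum>j. norm (c j)) - (\<Sum>j. norm (c j))"
    unfolding T_def using c by (intro tendsto_intros summable_LIMSEQ)
  then have "T \<longlonglongrightarrow> 0"
    by simp
  then have "(\<lambda>N. v N - c m) \<longlonglongrightarrow> 0"
    by (rule Lim_null_comparison[rotated]) (use vT in \<open>auto intro: eventually_mono[OF eventually_gt_at_top[of m]]\<close>)
  then have "v \<longlonglongrightarrow> c m"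
    by (simp add: LIM_zero_iff)
  moreover have "\<forall>\<^sub>F N in sequentially. v N \<in> K"
    using vK by (auto intro: eventually_mono[OF eventually_gt_at_top[of m]])
  ultimately show ?thesis
    using K(1) by (intro Lim_in_closed_set[of K v sequentially]) auto
qed


section \<open>Homogeneous polynomials and Taylor expansions\<close>

lemma hom_polys_scaleC:
  assumes "P \<in> hom_polys m"
  shows "P (c *\<^sub>C x) = c ^ m *\<^sub>C P x"
proof -
  obtain A where A: "multilinear_map m A" and P: "\<And>x. P x = A (\<lambda>_. x)"
    using assms by (auto simp: hom_polys_def)
  \<comment> \<open>The first \<open>k\<close> slots are scaled already; linearity in slot
    \<open>k\<close> pulls out one further factor \<open>c\<close>.\<close>
  define u where "u k = (\<lambda>i. if i < k then c *\<^sub>C x else x)" for k :: nat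
  have "A (u k) = c ^ k *\<^sub>C A (\<lambda>_. x)" if "k \<le> m" for k
    using that
  proof (induction k)
    case 0
    then show ?case
      by (simp add: u_def)
  next
    case (Suc k)
    have "Vector_Spaces.linear (*\<^sub>C) (*\<^sub>C) (\<lambda>y. A ((u k)(k := y)))"
      using A Suc.prems by (simp add: multilinear_map_def)
    then have "A ((u k)(k := c *\<^sub>C x)) = c *\<^sub>C A ((u k)(k := x))"
      unfolding Vector_Spaces.linear_iff by blast
    moreover have "(u k)(k := c *\<^sub>C x) = u (Suc k)" "(u k)(k := x) = u k"
      by (auto simp: u_def)
    ultimately show ?case
      using Suc by (simp add: scaleC_scaleC)
  qed
  \<comment> \<open>From slot \<open>m\<close> on the two arguments may differ, but \<open>A\<close>
    depends on the slots below \<open>m\<close> only.\<close>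
  moreover have "A (u m) = A (\<lambda>_. c *\<^sub>C x)"
    using A by (auto simp: multilinear_map_def u_def)
  ultimately show ?thesis
    by (simp add: P)
qed

lemma hom_polys_scaleR:
  assumes "P \<in> hom_polys m"
  shows "P (r *\<^sub>R x) = r ^ m *\<^sub>R P x"
  using hom_polys_scaleC[OF assms, of "of_real r" x] by (simp only: scaleC_of_real flip: of_real_power)

lemma has_taylor_expansion_imp_sums:
  fixes f :: "'e::complex_normed_vector \<Rightarrow> 'f::complex_normed_vector"
  assumes "has_taylor_expansion f x0 P"
  shows "\<exists>r>0. \<forall>x. norm x \<le> r \<longrightarrow> (\<lambda>m. P m x) sums f (x0 + x)"
proof -
  obtain V where V: "x0 \<in> interior V"
    and lim: "uniform_limit V (\<lambda>N x. \<Sum>m<N. P m (x - x0)) f sequentially"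
    using assms by (auto simp: has_taylor_expansion_def)
  obtain r where r: "0 < r" "cball x0 r \<subseteq> V"
    using V by (auto simp: mem_interior_cball)
  have "(\<lambda>m. P m x) sums f (x0 + x)" if "norm x \<le> r" for x
  proof -
    have "x0 + x \<in> V"
      using r that by (auto simp: subset_iff dist_norm)
    from tendsto_uniform_limitI[OF lim this] show ?thesis
      by (simp add: sums_def)
  qed
  then show ?thesis
    using r(1) by blast
qed

text \<open>Convergence at \<open>2 *\<^sub>R x\<close> bounds the terms there; by homogeneity the
  terms at \<open>x\<close> are dominated by \<open>M * (1/2) ^ m\<close>.\<close>

lemma summable_norm_hom_polys:
  assumes P: "\<And>m. P m \<in> hom_polys m" and s: "summable (\<lambda>m. P m (2 *\<^sub>R x) :: 'f::complex_banach)"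
  shows "summable (\<lambda>m. norm (P m x))"
proof -
  have "Bseq (\<lambda>m. P m (2 *\<^sub>R x))"
    by (rule convergent_imp_Bseq[OF convergentI[OF summable_LIMSEQ_zero[OF s]]])
  then obtain M where M: "\<And>m. norm (P m (2 *\<^sub>R x)) \<le> M"
    unfolding Bseq_def by blast
  show ?thesis
  proof (rule summable_comparison_test'[where N = 0])
    show "summable (\<lambda>m. M * (1/2) ^ m)"
      by (rule summable_mult, rule summable_geometric) simp
    fix m
    have "2 ^ m * norm (P m x) \<le> M"
      using M[of m] by (simp add: hom_polys_scaleR[OF P])
    then show "norm (norm (P m x)) \<le> M * (1/2) ^ m"
      by (simp add: field_simps power_divide)
  qed
qed

section \<open>Relative p-compactness and the infimum \<open>m_p\<close>\<close>

lemma rel_p_compactE: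
  assumes "rel_p_compact p K" "1 \<le> p"
  obtains y where "y \<in> lp_seqs p" "K \<subseteq> p_co p y"
  using assms by (auto simp: rel_p_compact_def)

lemma m_p_le:
  assumes "y \<in> lp_seqs p" "K \<subseteq> p_co p y"
  shows "m_p p K \<le> lp_norm p y"
  unfolding m_p_def
  by (rule cInf_lower) (use assms in \<open>auto intro!: bdd_belowI[of _ 0] simp: lp_norm_nonneg\<close>)

text \<open>Relative \<open>p\<close>-compactness makes the set of admissible norms nonempty, so
  \<open>Inf\<close> is a true infimum and every larger \<open>b\<close> is undercut by an actual
  sequence.\<close>

lemma m_p_less:
  assumes "rel_p_compact p K" "1 \<le> p" "m_p p K < b"
  obtains y where "y \<in> lp_seqs p" "K \<subseteq> p_co p y" "lp_norm p y < b"
proof -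
  obtain y0 where "y0 \<in> lp_seqs p" "K \<subseteq> p_co p y0"
    using assms(1,2) by (rule rel_p_compactE)
  then have "{lp_norm p y |y. y \<in> lp_seqs p \<and> K \<subseteq> p_co p y} \<noteq> {}"
    by blast
  from cInf_lessD[OF this assms(3)[unfolded m_p_def]] show thesis
    using that by blast
qed

lemma m_p_nonneg:
  assumes "rel_p_compact p K" "1 \<le> p"
  shows "0 \<le> m_p p K"
proof (rule ccontr)
  assume "\<not> 0 \<le> m_p p K"
  then obtain y where "lp_norm p (y :: nat \<Rightarrow> 'a) < 0"
    using m_p_less[OF assms, of 0] by force
  then show False
    using lp_norm_nonneg[of p y] by simp
qed

section \<open>From p-compactness to the Taylor polynomials\<close>

text \<open>A single \<open>y\<close> serves all degrees: for fixed small \<open>x\<close>, the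
  values of \<open>f\<close> on the circle of points \<open>x0 + u *\<^sub>C x\<close> lie in one
  set \<open>p_co p y\<close>, and the \<open>P m x\<close> are their coefficients as a power series
  in \<open>u\<close>.\<close>

lemma taylor_polys_in_p_co:
  fixes f :: "'e::complex_banach \<Rightarrow> 'f::complex_banach"
  assumes T: "has_taylor_expansion f x0 P" and p: "1 \<le> p" and f: "p_compact_at p f x0"
  shows "\<exists>e>0. \<exists>y\<in>lp_seqs p. \<forall>m x. norm x \<le> e \<longrightarrow> P m x \<in> p_co p y"
proof -
  obtain V where V: "x0 \<in> interior V" and fV: "rel_p_compact p (f ` V)"
    using f by (auto simp: p_compact_at_def)
  obtain y where y: "y \<in> lp_seqs p" "f ` V \<subseteq> p_co p y"
    using fV p by (rule rel_p_compactE)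
  obtain r1 where r1: "0 < r1" "cball x0 r1 \<subseteq> V"
    using V by (auto simp: mem_interior_cball)
  obtain r2 where r2: "0 < r2" "\<And>x. norm x \<le> r2 \<Longrightarrow> (\<lambda>m. P m x) sums f (x0 + x)"
    using has_taylor_expansion_imp_sums[OF T] by blast
  have P: "P m \<in> hom_polys m" for m
    using T by (simp add: has_taylor_expansion_def)
  \<comment> \<open>\<open>r1\<close> keeps the circle inside \<open>V\<close>; half of
    \<open>r2\<close> leaves \<open>2 *\<^sub>R x\<close> in the ball of convergence, which gives
    absolute summability at \<open>x\<close>.\<close>
  define e where "e = min r1 (r2 / 2)"
  have "0 < e"
    using r1 r2 by (simp add: e_def)
  moreover have "\<forall>m x. norm x \<le> e \<longrightarrow> P m x \<in> p_co p y"
  proof (intro allI impI)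
    fix m and x :: 'e
    assume x: "norm x \<le> e"
    show "P m x \<in> p_co p y"
    proof (rule coeff_in_closed_convex_balanced)
      show "closed (p_co p y)" "convex (p_co p y)"
        using p y by (auto intro: compact_imp_closed compact_p_co convex_p_co)
      show "u *\<^sub>C v \<in> p_co p y" if "v \<in> p_co p y" "cmod u = 1" for v u
        using that p y by (intro p_co_balanced) auto
      have "summable (\<lambda>m. P m (2 *\<^sub>R x))"
        by (rule sums_summable[OF r2(2)]) (use x in \<open>simp add: e_def\<close>)
      then show "summable (\<lambda>m. norm (P m x))"
        by (rule summable_norm_hom_polys[OF P])
      show "\<exists>s\<in>p_co p y. (\<lambda>j. u ^ j *\<^sub>C P j x) sums s" if u: "cmod u = 1" for u
      proof
        have "norm (u *\<^sub>C x) \<le> r1" "norm (u *\<^sub>C x) \<le> r2"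
          using x u r2(1) by (auto simp: norm_scaleC e_def)
        then show "f (x0 + u *\<^sub>C x) \<in> p_co p y" "(\<lambda>j. u ^ j *\<^sub>C P j x) sums f (x0 + u *\<^sub>C x)"
          using r1 r2(2)[of "u *\<^sub>C x"] y by (auto simp: hom_polys_scaleC[OF P] subset_iff dist_norm)
      qed
    qed
  qed
  ultimately show ?thesis
    using y(1) by blast
qed

lemma p_compact_at_imp_taylor_bound:
  fixes f :: "'e::complex_banach \<Rightarrow> 'f::complex_banach"
  assumes T: "has_taylor_expansion f x0 P" and p: "1 \<le> p" and f: "p_compact_at p f x0"
  shows "(\<forall>m. P m \<in> p_compact_polys p m) \<and> limsup (\<lambda>m. ereal (root m (kappa_p p (P m)))) < \<infinity>"
proof -
  obtain e y where e: "0 < e" and y: "y \<in> lp_seqs p"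
    and Py: "\<And>m x. norm x \<le> e \<Longrightarrow> P m x \<in> p_co p y"
    using taylor_polys_in_p_co[OF T p f] by blast
  have P: "P m \<in> hom_polys m" for m
    using T by (simp add: has_taylor_expansion_def)
  \<comment> \<open>By homogeneity, passing from the ball of radius \<open>e\<close> to the unit
    ball costs the factor \<open>(1 / e) ^ m\<close>.\<close>
  define z where "z m = (\<lambda>n. (1 / e) ^ m *\<^sub>R y n)" for m
  have z: "z m \<in> lp_seqs p" for m
    unfolding z_def by (rule lp_seqs_scaleR[OF y])
  have sub: "P m ` cball 0 1 \<subseteq> p_co p (z m)" for m
  proof safe
    fix x :: 'e
    assume "x \<in> cball 0 1"
    then have "P m (e *\<^sub>R x) \<in> p_co p y"
      using e by (intro Py) (simp add: mult_le_cancel_left1)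
    then have "(1 / e) ^ m *\<^sub>R P m (e *\<^sub>R x) \<in> p_co p (z m)"
      unfolding z_def by (rule p_co_scaleR[OF p y])
    then show "P m x \<in> p_co p (z m)"
      using e by (simp add: hom_polys_scaleR[OF P] flip: power_mult_distrib)
  qed
  have comp: "rel_p_compact p (P m ` cball 0 1)" for m
    unfolding rel_p_compact_def using z sub p by (intro bexI[of _ "z m"]) simp_all
  \<comment> \<open>The maximum with 1 gives \<open>lp_norm p y \<le> L ^ m\<close> for
    \<open>0 < m\<close>, so the \<open>m\<close>-th root has a bound independent of
    \<open>m\<close>.\<close>
  define L where "L = max 1 (lp_norm p y)"
  have root_le: "root m (kappa_p p (P m)) \<le> 1 / e * L" if m: "0 < m" for m
  proof -
    have "kappa_p p (P m) \<le> lp_norm p (z m)"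
      unfolding kappa_p_def by (rule m_p_le[OF z sub])
    also have "\<dots> = (1 / e) ^ m * lp_norm p y"
      unfolding z_def using e by (simp add: lp_norm_scaleR[OF p y])
    also have "\<dots> \<le> (1 / e) ^ m * L ^ m"
      using e m self_le_power[of L m] by (intro mult_left_mono) (auto simp: L_def)
    finally have "root m (kappa_p p (P m)) \<le> root m ((1 / e * L) ^ m)"
      using m by (simp add: power_divide)
    also have "\<dots> = 1 / e * L"
      using m e by (intro real_root_power_cancel) (auto simp: L_def)
    finally show ?thesis .
  qed
  have "limsup (\<lambda>m. ereal (root m (kappa_p p (P m)))) \<le> ereal (1 / e * L)"
    using root_le by (intro Limsup_bounded eventually_mono[OF eventually_gt_at_top[of 0]]) simp
  also have "\<dots> < \<infinity>"
    by simp
  finally show ?thesis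
    using P comp by (simp add: p_compact_polys_def)
qed

section \<open>From bounds on the Taylor polynomials to p-compactness\<close>

lemma taylor_bound_imp_p_compact_at:
  fixes f :: "'e::complex_banach \<Rightarrow> 'f::complex_banach"
  assumes T: "has_taylor_expansion f x0 P" and p: "1 \<le> p"
    and P: "\<And>m. P m \<in> p_compact_polys p m"
    and bound: "limsup (\<lambda>m. ereal (root m (kappa_p p (P m)))) < \<infinity>"
  shows "p_compact_at p f x0"
proof -
  have hom: "P m \<in> hom_polys m" and comp: "rel_p_compact p (P m ` cball 0 1)" for m
    using P by (auto simp: p_compact_polys_def)
  have nonneg: "0 \<le> kappa_p p (P m)" for m
    unfolding kappa_p_def by (rule m_p_nonneg[OF comp p])
  \<comment> \<open>A finite limsup of a real sequence bounds all its terms. As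
    \<open>root 0\<close> is constantly 0, the term at \<open>m = 0\<close> carries no information
    on \<open>kappa_p p (P 0)\<close>, which enters through \<open>D\<close> instead.\<close>
  obtain C0 where C0: "\<And>m. root m (kappa_p p (P m)) \<le> C0"
    using limsup_finite_then_bounded[OF bound] by blast
  define C where "C = max 1 C0"
  \<comment> \<open>\<open>D\<close> exceeds \<open>kappa_p p (P 0)\<close>, which settles
    \<open>m = 0\<close>, and exceeds 1, which makes the bound strict for \<open>0 < m\<close>.
    Strictness is what \<open>m_p_less\<close> asks for.\<close>
  define D where "D = kappa_p p (P 0) + 2"
  have C: "1 \<le> C"
    by (simp add: C_def)
  have less: "kappa_p p (P m) < D * C ^ m" for m
  proof (cases "m = 0")
    case False
    then have "kappa_p p (P m) = root m (kappa_p p (P m)) ^ m"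
      using nonneg by simp
    also have "\<dots> \<le> C ^ m"
      using C0[of m] nonneg[of m] False by (intro power_mono) (auto simp: C_def)
    also have "\<dots> < D * C ^ m"
      using C nonneg[of 0] by (simp add: D_def)
    finally show ?thesis .
  qed (simp add: D_def)
  have "\<exists>y. y \<in> lp_seqs p \<and> P m ` cball 0 1 \<subseteq> p_co p y \<and> lp_norm p y < D * C ^ m" for m
  proof -
    obtain y where "y \<in> lp_seqs p" "P m ` cball 0 1 \<subseteq> p_co p y" "lp_norm p y < D * C ^ m"
      using comp p less[of m, unfolded kappa_p_def] by (rule m_p_less)
    then show ?thesis
      by blast
  qed
  then obtain y where y: "\<And>m. y m \<in> lp_seqs p" "\<And>m. P m ` cball 0 1 \<subseteq> p_co p (y m)"
      "\<And>m. lp_norm p (y m) < D * C ^ m"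
    by metis
  \<comment> \<open>For \<open>norm x \<le> 1 / (4 * C)\<close> homogeneity contributes
    \<open>(1 / (4 * C)) ^ m\<close>: its part in \<open>C\<close> cancels the growth of
    \<open>y m\<close>, and \<open>1 / 4 ^ m\<close> is the decay that \<open>p_co_sums\<close>
    requires.\<close>
  define z where "z m = (\<lambda>n. (1 / (4 * C)) ^ m *\<^sub>R y m n)" for m
  have z: "z m \<in> lp_seqs p" for m
    unfolding z_def by (rule lp_seqs_scaleR[OF y(1)])
  have zD: "lp_norm p (z m) \<le> D / 4 ^ m" for m
  proof -
    have "lp_norm p (z m) = (1 / (4 * C)) ^ m * lp_norm p (y m)"
      unfolding z_def using C by (simp add: lp_norm_scaleR[OF p y(1)])
    also have "\<dots> \<le> (1 / (4 * C)) ^ m * (D * C ^ m)"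
      using y(3)[of m] C by (intro mult_left_mono) auto
    also have "\<dots> = D / 4 ^ m"
      using C by (simp add: field_simps)
    finally show ?thesis .
  qed
  have Pz: "P m x \<in> p_co p (z m)" if x: "norm x \<le> 1 / (4 * C)" for m x
  proof -
    have "(4 * C) *\<^sub>R x \<in> cball 0 1"
      using x C by (simp add: field_simps)
    then have "(1 / (4 * C)) ^ m *\<^sub>R P m ((4 * C) *\<^sub>R x) \<in> p_co p (z m)"
      unfolding z_def using y(2) by (intro p_co_scaleR[OF p y(1)]) blast
    moreover have "(1 / (4 * C)) ^ m * (4 * C) ^ m = 1"
      unfolding power_mult_distrib[symmetric] using C by simp
    ultimately show ?thesis
      by (simp only: hom_polys_scaleR[OF hom] scaleR_scaleR scaleR_one)
  qed
  obtain w where w: "w \<in> lp_seqs p"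
    and sums_w: "\<And>v s. (\<forall>m. v m \<in> p_co p (z m)) \<Longrightarrow> v sums s \<Longrightarrow> s \<in> p_co p w"
    using p_co_sums[OF p z zD] by blast
  obtain r where r: "0 < r" "\<And>x. norm x \<le> r \<Longrightarrow> (\<lambda>m. P m x) sums f (x0 + x)"
    using has_taylor_expansion_imp_sums[OF T] by blast
  \<comment> \<open>One radius ensures convergence of the Taylor series, the other puts every
    \<open>P m (x - x0)\<close> into \<open>p_co p (z m)\<close>.\<close>
  define V where "V = cball x0 (min r (1 / (4 * C)))"
  have "f x \<in> p_co p w" if "x \<in> V" for x
  proof -
    have x: "norm (x - x0) \<le> r" "norm (x - x0) \<le> 1 / (4 * C)"
      using that by (auto simp: V_def dist_norm norm_minus_commute)
    show ?thesis
      using sums_w[OF _ r(2)[OF x(1)]] Pz[OF x(2)] by simp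
  qed
  then have "rel_p_compact p (f ` V)"
    using w p by (auto simp: rel_p_compact_def)
  moreover have "x0 \<in> interior V"
    unfolding mem_interior_cball V_def using r(1) C
    by (intro exI[of _ "min r (1 / (4 * C))"]) simp
  ultimately show ?thesis
    by (auto simp: p_compact_at_def)
qed

theorem proposition3p4:
  fixes f :: "'e::complex_banach \<Rightarrow> 'f::complex_banach"
    and x0 :: 'e
    and P :: "nat \<Rightarrow> 'e \<Rightarrow> 'f"
    and p :: real
  assumes "entire f"
    and "has_taylor_expansion f x0 P"
    and "1 \<le> p"
  shows "p_compact_at p f x0 \<longleftrightarrow>
    (\<forall>m. P m \<in> p_compact_polys p m) \<and>
    limsup (\<lambda>m. ereal (root m (kappa_p p (P m)))) < \<infinity>"
  using p_compact_at_imp_taylor_bound[OF assms(2,3)] taylor_bound_imp_p_compact_at[OF assms(2,3)]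
  by blast

end
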